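(* Assume that for each $i$, $J_i$ is continuously differentiable and convex in $x_i$ for given $x_{-i}$, that $\mathcal X$ satisfies Slater's condition, that $G$ has full row rank, and that the communication graph $\mathcal G$ is undirected and connected. Let $c>0$, $\alpha>0$, and let $(\bar{\mathbf x},\bar z)$ be an equilibrium of the dynamics $$\dot{\mathbf x}=-\mathcal R^\top\mathbf F(\mathbf x)-\mathcal R^\top G_d^\top\lambda-c\,\mathbf L\mathbf x,\qquad \dot z=L\lambda,$$ $$\lambda=\Lambda(\mathbf x,z):=\operatorname*{arg\,min}_{\lambda\ge0}\ \tfrac12\|G_d^\top\lambda\|^2+\lambda^\top\big[G_d\mathbf F(\mathbf x)+cG_d\mathcal R\mathbf L\mathbf x-\alpha(G_d\mathcal R\mathbf x-H_s)+Lz\big]+\tfrac12\lambda^\top L\lambda .$$ Then $\bar{\mathbf x}$ lies in the consensus subspace, i.e. $\bar{\mathbf x}=\mathbf 1_N\otimes\bar x$ for some $\bar x\in\mathbb R^n$. Moreover, $\bar x$ together with the corresponding dual variable $\bar\lambda=\Lambda(\bar{\mathbf x},\bar z)$ solves the KKT conditions $$F(\bar x)+G_d^\top\bar\lambda=0,\quad \bar\lambda^\top[\mathbf 1_N\otimes(G\bar x-H)]=0,\quad G\bar x-H\le0,\quad \bar\lambda\ge0,$$ and $\bar\lambda=\mathbf 1_N\otimes\underline\lambda$ for some $\underline\lambda\in\mathbb R^m_+$. Hence $\bar x=\mathcal R\bar{\mathbf x}$ is a v-GNE of the game.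
   Context: Game. There are $N$ players indexed by $\mathcal I=\{1,\dots,N\}$. Player $i$ chooses $x_i\in\mathbb R^{n_i}$; $n=\sum_i n_i$; $x=\mathrm{col}\{x_i\}_{i\in\mathcal I}\in\mathbb R^n$ is the stacked vector and $x_{-i}$ the stacked vector of the decisions of all players other than $i$. Player $i$ has objective $J_i(x_i,x_{-i})$ and local constraint data $g_i\in\mathbb R^{m\times n_i}$, $h_i\in\mathbb R^m$. Put $G=[g_1\ \cdots\ g_N]$, $H=\sum_i h_i$, $\mathcal X=\{x\in\mathbb R^n\mid Gx-H\le 0\}$, $G_d=\mathrm{diag}\{g_i\}_{i\in\mathcal I}$ (block diagonal), $H_s=\mathrm{col}\{h_i\}_{i\in\mathcal I}$, and $F(x)=\mathrm{col}\{\nabla_{x_i}J_i(x_i,x_{-i})\}_{i\in\mathcal I}$. Inequalities between vectors are entrywise. The game is: for each $i$, $\min_{x_i} J_i(x_i,x_{-i})$ subject to $(x_i,x_{-i})\in\mathcal X$. A GNE is $x^*$ such that, for all $i$, $x_i^*$ minimizes $J_i(x_i,x_{-i}^* )$ over $x_i$ with $(x_i,x_{-i}^* )\in\mathcal X$. A v-GNE (variational GNE) is a GNE that solves VI$(\mathcal X,F)$, i.e. $x^*\in\mathcal X$ and $(x-x^* )^\top F(x^* )\ge0$ for all $x\in\mathcal X$; equivalently, the KKT conditions hold with all players' multipliers $\lambda_i^*\in\mathbb R^m_+$ identical. Communication graph: $\mathcal G$ is an undirected weighted graph on $\mathcal I$ with symmetric adjacency matrix $\mathcal A=[a_{ij}]$,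 $a_{ij}\ge0$, $a_{ii}=0$, $a_{ij}>0$ iff $(i,j)$ is an edge; Laplacian $\mathcal L=\mathrm{diag}\{\mathcal A\mathbf 1_N\}-\mathcal A$; $L=\mathcal L\otimes I_m$, $\mathbf L=\mathcal L\otimes I_n$. The variables $z=\mathrm{col}\{z_i\}$, $\lambda=\mathrm{col}\{\lambda_i\}$ have $z_i,\lambda_i\in\mathbb R^m$. $\mathbf 1_N$ is the all-ones vector. Partial information: player $i$ keeps an augmented vector $\mathbf x_i=\mathrm{col}\{\mathbf x_i^1,\dots,\mathbf x_i^{i-1},x_i,\mathbf x_i^{i+1},\dots,\mathbf x_i^N\}\in\mathbb R^n$, where $\mathbf x_i^j\in\mathbb R^{n_j}$ is its estimate of player $j$'s decision; $\mathbf x=\mathrm{col}\{\mathbf x_i\}_{i\in\mathcal I}\in\mathbb R^{Nn}$. $\mathcal R_i=[\,0_{n_i\times\sum_{j<i}n_j}\ \ I_{n_i}\ \ 0_{n_i\times\sum_{j>i}n_j}\,]$ (so $x_i=\mathcal R_i\mathbf x_i$), $\mathcal R=\mathrm{diag}\{\mathcal R_i\}_{i\in\mathcal I}$ (so $x=\mathcal R\mathbf x$). Extended pseudo-gradient: $\mathbf F(\mathbf x)=\mathrm{col}\{\nabla_{x_i}J_i(\mathbf x_i)\}_{i\in\mathcal I}$, where $\nabla_{x_i}J_i(\mathbf x_i)$ is the partial gradient of $J_i$ in the $i$-th block evaluated at the profile $\mathbf x_i$. *)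

theory Defs
  imports "HOL-Analysis.Analysis"
begin

text \<open>
  The players are the elements of a finite type \<open>'i\<close>.  The coordinates of the stacked decision
  vector \<open>x = col(x_i)\<close> are indexed by a finite type \<open>'n\<close>, and \<open>own :: 'n \<Rightarrow> 'i\<close> says which player
  a coordinate belongs to: \<open>x_i\<close> consists of the coordinates \<open>k\<close> with \<open>own k = i\<close>, so that
  \<open>n_i = card {k. own k = i}\<close>.  The rows of the constraints are indexed by \<open>'m\<close>.  A vector made of
  one \<open>d\<close>-dimensional block per player has type \<open>real^('i \<times> 'd)\<close>.
\<close>

section \<open>Block vectors and matrices\<close>

definition kron :: "real^'b^'a::finite \<Rightarrow> real^'d^'c::finite \<Rightarrow> real^('b \<times> 'd)^('a \<times> 'c)" where
  "kron A B = (\<chi> p q. A $ fst p $ fst q * B $ snd p $ snd q)"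

definition kron_vec :: "real^'a \<Rightarrow> real^'c \<Rightarrow> real^('a \<times> 'c)" where
  "kron_vec u v = (\<chi> p. u $ fst p * v $ snd p)"

definition block :: "real^('i::finite \<times> 'd) \<Rightarrow> 'i \<Rightarrow> real^'d" where
  "block v i = (\<chi> k. v $ (i, k))"

definition col :: "('i::finite \<Rightarrow> real^'d) \<Rightarrow> real^('i \<times> 'd)" where
  "col w = (\<chi> p. w (fst p) $ snd p)"

definition diag :: "real^'a \<Rightarrow> real^'a^'a" where
  "diag d = (\<chi> i j. if i = j then d $ i else 0)"

section \<open>Communication graph\<close>

definition weighted_graph :: "('i \<times> 'i) set \<Rightarrow> real^'i^'i \<Rightarrow> bool" where
  "weighted_graph E A \<longleftrightarrow> sym E \<and> transpose A = A \<and> (\<forall>i. A $ i $ i = 0) \<and>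
     (\<forall>i j. 0 \<le> A $ i $ j \<and> (0 < A $ i $ j \<longleftrightarrow> (i, j) \<in> E))"

definition connected_graph :: "('i::finite \<times> 'i) set \<Rightarrow> bool" where
  "connected_graph E \<longleftrightarrow> (\<forall>i j. (i, j) \<in> E\<^sup>*)"

definition laplacian :: "real^'i^'i \<Rightarrow> real^'i^'i" where
  "laplacian A = diag (A *v 1) - A"

section \<open>Game\<close>

text \<open>The profile \<open>(y_i, x_{-i})\<close>; of \<open>y\<close> only the block of player \<open>i\<close> matters.\<close>

definition profile :: "('n \<Rightarrow> 'i::finite) \<Rightarrow> 'i \<Rightarrow> real^'n \<Rightarrow> real^'n \<Rightarrow> real^'n" where
  "profile own i y x = (\<chi> k. if own k = i then y $ k else x $ k)"

definition grad :: "(real^'n \<Rightarrow> real) \<Rightarrow> real^'n \<Rightarrow> real^'n" where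
  "grad f x = (THE D. GDERIV f x :> D)"

definition continuously_differentiable :: "(real^'n \<Rightarrow> real) \<Rightarrow> bool" where
  "continuously_differentiable f \<longleftrightarrow>
     (\<exists>D. (\<forall>x. GDERIV f x :> D x) \<and> continuous_on UNIV D)"

text \<open>
  The partial gradient of \<open>f\<close> in block \<open>i\<close> at the profile \<open>x\<close>, padded with zeros to an element of
  \<open>real^'n\<close>: the differentiated function depends only on block \<open>i\<close> of its argument.
\<close>

definition partial_grad ::
    "('n \<Rightarrow> 'i::finite) \<Rightarrow> 'i \<Rightarrow> (real^'n \<Rightarrow> real) \<Rightarrow> real^'n \<Rightarrow> real^'n" where
  "partial_grad own i f x = grad (\<lambda>y. f (profile own i y x)) x"

definition pseudo_grad :: "('n \<Rightarrow> 'i::finite) \<Rightarrow> ('i \<Rightarrow> real^'n \<Rightarrow> real) \<Rightarrow> real^'n \<Rightarrow> real^'n" where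
  "pseudo_grad own J x = (\<chi> k. partial_grad own (own k) (J (own k)) x $ k)"

definition ext_pseudo_grad ::
    "('n \<Rightarrow> 'i::finite) \<Rightarrow> ('i \<Rightarrow> real^'n \<Rightarrow> real) \<Rightarrow> real^('i \<times> 'n) \<Rightarrow> real^'n" where
  "ext_pseudo_grad own J xx =
     (\<chi> k. partial_grad own (own k) (J (own k)) (block xx (own k)) $ k)"

text \<open>
  The \<open>m \<times> n_i\<close> matrix \<open>g_i\<close> is given by those columns of \<open>g i\<close> that belong to player \<open>i\<close>; the
  other columns of \<open>g i\<close> are never used.
\<close>

definition hcat :: "('n \<Rightarrow> 'i::finite) \<Rightarrow> ('i \<Rightarrow> real^'n^'m::finite) \<Rightarrow> real^'n^'m" where
  "hcat own g = (\<chi> r k. g (own k) $ r $ k)"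

definition block_diag :: "('n \<Rightarrow> 'i::finite) \<Rightarrow> ('i \<Rightarrow> real^'n^'m::finite) \<Rightarrow> real^'n^('i \<times> 'm)" where
  "block_diag own g = (\<chi> p k. if own k = fst p then g (fst p) $ snd p $ k else 0)"

text \<open>
  \<open>\<R> = diag(\<R>_i)\<close>: row \<open>k\<close> is a row of \<open>\<R>_i\<close> for \<open>i = own k\<close>, which selects coordinate \<open>k\<close> of the
  augmented vector of player \<open>i\<close>.
\<close>

definition sel :: "('n::finite \<Rightarrow> 'i::finite) \<Rightarrow> real^('i \<times> 'n)^'n" where
  "sel own = (\<chi> k p. if fst p = own k \<and> snd p = k then 1 else 0)"

definition feasible ::
    "('n \<Rightarrow> 'i::finite) \<Rightarrow> ('i \<Rightarrow> real^'n^'m) \<Rightarrow> ('i \<Rightarrow> real^'m) \<Rightarrow> (real^'n) set" where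
  "feasible own g h = {x. hcat own g *v x - (\<Sum>i\<in>UNIV. h i) \<le> 0}"

definition slater ::
    "('n \<Rightarrow> 'i::finite) \<Rightarrow> ('i \<Rightarrow> real^'n^'m) \<Rightarrow> ('i \<Rightarrow> real^'m) \<Rightarrow> bool" where
  "slater own g h \<longleftrightarrow> (\<exists>x. \<forall>r. (hcat own g *v x - (\<Sum>i\<in>UNIV. h i)) $ r < 0)"

definition is_GNE ::
    "('n \<Rightarrow> 'i::finite) \<Rightarrow> ('i \<Rightarrow> real^'n \<Rightarrow> real) \<Rightarrow> (real^'n) set \<Rightarrow> real^'n \<Rightarrow> bool" where
  "is_GNE own J X x \<longleftrightarrow>
     (\<forall>i. is_arg_min (\<lambda>y. J i (profile own i y x)) (\<lambda>y. profile own i y x \<in> X) x)"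

definition solves_VI :: "(real^'n) set \<Rightarrow> (real^'n \<Rightarrow> real^'n) \<Rightarrow> real^'n \<Rightarrow> bool" where
  "solves_VI X F x \<longleftrightarrow> x \<in> X \<and> (\<forall>y\<in>X. 0 \<le> (y - x) \<bullet> F x)"

definition is_vGNE ::
    "('n \<Rightarrow> 'i::finite) \<Rightarrow> ('i \<Rightarrow> real^'n \<Rightarrow> real) \<Rightarrow> (real^'n) set \<Rightarrow> real^'n \<Rightarrow> bool" where
  "is_vGNE own J X x \<longleftrightarrow> is_GNE own J X x \<and> solves_VI X (pseudo_grad own J) x"

section \<open>Dynamics under partial information\<close>

definition dual_objective ::
    "('n \<Rightarrow> 'i) \<Rightarrow> ('i \<Rightarrow> real^'n \<Rightarrow> real) \<Rightarrow> ('i \<Rightarrow> real^'n^'m) \<Rightarrow> ('i \<Rightarrow> real^'m) \<Rightarrow>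
     real^'i^'i \<Rightarrow> real \<Rightarrow> real \<Rightarrow> real^('i \<times> 'n) \<Rightarrow> real^('i \<times> 'm) \<Rightarrow> real^('i \<times> 'm) \<Rightarrow> real" where
  "dual_objective own J g h A c \<alpha> xx z l =
     (let Gd = block_diag own g; L = kron (laplacian A) (mat 1) in
      1 / 2 * (norm (transpose Gd *v l))\<^sup>2
      + l \<bullet> (Gd *v ext_pseudo_grad own J xx + c *\<^sub>R (Gd *v (sel own *v (kron (laplacian A) (mat 1) *v xx)))
             - \<alpha> *\<^sub>R (Gd *v (sel own *v xx) - col h) + L *v z)
      + 1 / 2 * (l \<bullet> (L *v l)))"

definition dual_map ::
    "('n \<Rightarrow> 'i) \<Rightarrow> ('i \<Rightarrow> real^'n \<Rightarrow> real) \<Rightarrow> ('i \<Rightarrow> real^'n^'m) \<Rightarrow> ('i \<Rightarrow> real^'m) \<Rightarrow>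
     real^'i^'i \<Rightarrow> real \<Rightarrow> real \<Rightarrow> real^('i \<times> 'n) \<Rightarrow> real^('i \<times> 'm) \<Rightarrow> real^('i \<times> 'm)" where
  "dual_map own J g h A c \<alpha> xx z = arg_min (dual_objective own J g h A c \<alpha> xx z) (\<lambda>l. 0 \<le> l)"

definition x_field ::
    "('n \<Rightarrow> 'i) \<Rightarrow> ('i \<Rightarrow> real^'n \<Rightarrow> real) \<Rightarrow> ('i \<Rightarrow> real^'n^'m) \<Rightarrow> ('i \<Rightarrow> real^'m) \<Rightarrow>
     real^'i^'i \<Rightarrow> real \<Rightarrow> real \<Rightarrow> real^('i \<times> 'n) \<Rightarrow> real^('i \<times> 'm) \<Rightarrow> real^('i \<times> 'n)" where
  "x_field own J g h A c \<alpha> xx z =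
     - (transpose (sel own) *v ext_pseudo_grad own J xx)
     - transpose (sel own) *v (transpose (block_diag own g) *v dual_map own J g h A c \<alpha> xx z)
     - c *\<^sub>R (kron (laplacian A) (mat 1) *v xx)"

definition z_field ::
    "('n \<Rightarrow> 'i) \<Rightarrow> ('i \<Rightarrow> real^'n \<Rightarrow> real) \<Rightarrow> ('i \<Rightarrow> real^'n^'m) \<Rightarrow> ('i \<Rightarrow> real^'m) \<Rightarrow>
     real^'i^'i \<Rightarrow> real \<Rightarrow> real \<Rightarrow> real^('i \<times> 'n) \<Rightarrow> real^('i \<times> 'm) \<Rightarrow> real^('i \<times> 'm)" where
  "z_field own J g h A c \<alpha> xx z =
     kron (laplacian A) (mat 1) *v dual_map own J g h A c \<alpha> xx z"

definition is_equilibrium ::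
    "('n \<Rightarrow> 'i) \<Rightarrow> ('i \<Rightarrow> real^'n \<Rightarrow> real) \<Rightarrow> ('i \<Rightarrow> real^'n^'m) \<Rightarrow> ('i \<Rightarrow> real^'m) \<Rightarrow>
     real^'i^'i \<Rightarrow> real \<Rightarrow> real \<Rightarrow> real^('i \<times> 'n) \<Rightarrow> real^('i \<times> 'm) \<Rightarrow> bool" where
  "is_equilibrium own J g h A c \<alpha> xx z \<longleftrightarrow>
     x_field own J g h A c \<alpha> xx z = 0 \<and> z_field own J g h A c \<alpha> xx z = 0"

end

theory Submission
  imports Defs
begin

text \<open>
  Since \<open>1\<^sup>T \<L> = 0\<close> and \<open>(1\<^sup>T \<otimes> I) \<R>\<^sup>T = I\<close>, left multiplication of the stationarity
  equation in \<open>x\<close> by \<open>1\<^sup>T \<otimes> I\<close> removes the consensus term and leaves \<open>F + G\<^sub>d\<^sup>T \<lambda> = 0\<close>; then the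
  consensus term vanishes on its own, so \<open>x\<close> is in consensus by connectedness, as is \<open>\<lambda>\<close>.  With
  these equations the gradient of the dual objective at its minimizer reduces to
  \<open>- \<alpha> (G\<^sub>d x - H\<^sub>s) + L z\<close>; the complementarity conditions over \<open>\<lambda> \<ge> 0\<close>, summed over the players,
  are the missing KKT conditions.  The minimizer exists because \<open>G\<^sub>d G\<^sub>d\<^sup>T + L\<close> is positive definite
  when \<open>G\<close> has full row rank.
\<close>

text \<open>As a simp rule it would turn \<open>transpose M *v x\<close> into \<open>x v* M\<close>,
  away from the form used in the dynamics and the KKT conditions.\<close>

declare transpose_matrix_vector [simp del]

section \<open>Quadratic programs and convex functions\<close>

lemma inner_matrix_vector_transpose:
  fixes M :: "real^'n^'m"
  shows "x \<bullet> (M *v y) = (transpose M *v x) \<bullet> y"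
  by (simp add: dot_lmul_matrix transpose_matrix_vector)

text \<open>Coercivity: the quadratic form dominates a positive multiple of the squared norm, so a
  minimizer over a large enough ball is global.\<close>

lemma quadratic_attains_min:
  fixes Q :: "real^'n^'n" and b :: "real^'n"
  assumes pd: "\<And>x. x \<noteq> 0 \<Longrightarrow> 0 < x \<bullet> (Q *v x)" and S: "closed S" "S \<noteq> {}"
  shows "\<exists>x. is_arg_min (\<lambda>x. 1 / 2 * (x \<bullet> (Q *v x)) + x \<bullet> b) (\<lambda>x. x \<in> S) x"
proof -
  let ?f = "\<lambda>x. 1 / 2 * (x \<bullet> (Q *v x)) + x \<bullet> b"
  have cont: "continuous_on T ?f" for T
    by (intro continuous_intros linear_continuous_on matrix_vector_mul_bounded_linear)
  have contQ: "continuous_on T (\<lambda>x. x \<bullet> (Q *v x))" for T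
    by (intro continuous_intros linear_continuous_on matrix_vector_mul_bounded_linear)
  have "sphere (0::real^'n) 1 \<noteq> {}"
    by (simp add: sphere_eq_empty)
  then have "\<exists>u\<in>sphere 0 1. \<forall>v\<in>sphere 0 1. u \<bullet> (Q *v u) \<le> v \<bullet> (Q *v v)"
    by (intro continuous_attains_inf compact_sphere contQ)
  then obtain u where u: "u \<in> sphere 0 1"
    and umin: "\<And>v. v \<in> sphere 0 1 \<Longrightarrow> u \<bullet> (Q *v u) \<le> v \<bullet> (Q *v v)"
    by (elim bexE) simp
  \<comment> \<open>The least value of the form on the unit sphere; homogeneity of degree two
    spreads this bound to all vectors in \<open>lower\<close>.\<close>
  define m where "m = u \<bullet> (Q *v u)"
  have "m > 0"
    using pd[of u] u by (cases "u = 0") (auto simp: m_def)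
  have lower: "m * (norm x)\<^sup>2 \<le> x \<bullet> (Q *v x)" for x
  proof (cases "x = 0")
    case False
    define v where "v = (1 / norm x) *\<^sub>R x"
    have x: "norm x *\<^sub>R v = x"
      using False by (simp add: v_def)
    have "norm v = 1"
      using False by (simp add: v_def)
    then have "m \<le> v \<bullet> (Q *v v)"
      using umin[of v] by (simp add: m_def)
    moreover have "(norm x *\<^sub>R v) \<bullet> (Q *v (norm x *\<^sub>R v)) = (norm x)\<^sup>2 * (v \<bullet> (Q *v v))"
      by (simp add: matrix_vector_mult_scaleR power2_eq_square mult.assoc)
    ultimately show ?thesis
      unfolding x by (simp add: mult.commute mult_right_mono)
  qed simp
  obtain a where a: "a \<in> S"
    using S by blast
  define fa where "fa = ?f a"
  define K where "K = norm b + \<bar>fa\<bar>"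
  \<comment> \<open>\<open>norm a\<close> puts \<open>a\<close> into the ball. Beyond
    \<open>2 * K / m\<close> half the quadratic bound exceeds \<open>norm y * K\<close>, which pays
    for both \<open>y \<bullet> b\<close> and \<open>fa\<close>; the summand 1 ensures
    \<open>1 \<le> norm y\<close>, needed for the latter.\<close>
  define r where "r = norm a + 2 * K / m + 1"
  have "0 \<le> K"
    by (simp add: K_def)
  then have r: "r \<ge> 1" "norm a \<le> r" "2 * K / m \<le> r"
    using \<open>m > 0\<close> by (auto simp: r_def)
  have "compact (S \<inter> cball 0 r)"
    using S(1) compact_cball by (rule closed_Int_compact)
  moreover have a_in: "a \<in> S \<inter> cball 0 r"
    using a r by simp
  ultimately have "\<exists>x\<in>S \<inter> cball 0 r. \<forall>y\<in>S \<inter> cball 0 r. ?f x \<le> ?f y"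
    by (intro continuous_attains_inf cont) auto
  then obtain x where x: "x \<in> S \<inter> cball 0 r"
    and xmin: "\<And>y. y \<in> S \<inter> cball 0 r \<Longrightarrow> ?f x \<le> ?f y"
    by (elim bexE) simp
  have "?f x \<le> ?f y" if "y \<in> S" for y
  proof (cases "norm y \<le> r")
    case True
    then show ?thesis using that by (intro xmin) simp
  next
    case False
    then have s: "1 \<le> norm y" "2 * K / m \<le> norm y"
      using r by linarith+
    then have "K \<le> m * norm y / 2"
      using \<open>m > 0\<close> by (simp add: pos_divide_le_eq mult.commute)
    then have "norm y * K \<le> norm y * (m * norm y / 2)"
      by (intro mult_left_mono) auto
    moreover have "1 * \<bar>fa\<bar> \<le> norm y * \<bar>fa\<bar>"
      by (rule mult_right_mono[OF s(1) abs_ge_zero])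
    moreover have "- (norm y * norm b) \<le> y \<bullet> b"
      using Cauchy_Schwarz_ineq2[of y b] by linarith
    moreover have "norm y * (m * norm y / 2) \<le> 1 / 2 * (y \<bullet> (Q *v y))"
      using lower[of y] by (simp add: power2_eq_square mult_ac)
    moreover have "norm y * K = norm y * norm b + norm y * \<bar>fa\<bar>"
      by (simp only: K_def distrib_left)
    ultimately have "fa \<le> ?f y"
      using abs_ge_self[of fa] by linarith
    moreover have "?f x \<le> fa"
      unfolding fa_def by (rule xmin[OF a_in])
    ultimately show ?thesis by linarith
  qed
  then have "is_arg_min ?f (\<lambda>x. x \<in> S) x"
    using x by (auto simp: is_arg_min_linorder)
  then show ?thesis by blast
qed

text \<open>If the directional derivative towards \<open>y\<close> were negative, a short step along
  the segment from \<open>x\<close> to \<open>y\<close> would lower the objective.\<close>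

lemma quadratic_min_variational:
  fixes Q :: "real^'n^'n" and b :: "real^'n"
  assumes sym: "transpose Q = Q" and S: "convex S" "y \<in> S"
    and min: "is_arg_min (\<lambda>x. 1 / 2 * (x \<bullet> (Q *v x)) + x \<bullet> b) (\<lambda>x. x \<in> S) x"
  shows "0 \<le> (y - x) \<bullet> (Q *v x + b)"
proof (rule ccontr)
  define d where "d = y - x"
  define e where "e = d \<bullet> (Q *v d)"
  define a where "a = d \<bullet> (Q *v x + b)"
  assume "\<not> ?thesis"
  then have "a < 0" by (simp add: a_def d_def)
  \<comment> \<open>The bound 1 keeps the step inside \<open>S\<close>; the other bound makes the
    second-order term \<open>t * e / 2\<close> smaller than \<open>- a\<close>.\<close>
  define t where "t = min 1 (- a / (\<bar>e\<bar> + 1))"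
  have t: "0 < t" "t \<le> 1"
    using \<open>a < 0\<close> by (auto simp: t_def divide_neg_pos)
  have "x \<in> S"
    using min by (simp add: is_arg_min_def)
  then have "(1 - t) *\<^sub>R x + t *\<^sub>R y \<in> S"
    using S t by (simp add: convexD_alt)
  then have "x + t *\<^sub>R d \<in> S"
    by (simp add: d_def algebra_simps)
  then have *: "1 / 2 * (x \<bullet> (Q *v x)) + x \<bullet> b
      \<le> 1 / 2 * ((x + t *\<^sub>R d) \<bullet> (Q *v (x + t *\<^sub>R d))) + (x + t *\<^sub>R d) \<bullet> b"
    using min by (auto simp: is_arg_min_linorder)
  have swap: "x \<bullet> (Q *v d) = d \<bullet> (Q *v x)"
    by (simp add: inner_matrix_vector_transpose[of x] sym inner_commute)
  have "0 \<le> t * a + 1 / 2 * (t * (t * e))"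
    using * swap unfolding a_def e_def
    by (simp add: matrix_vector_right_distrib matrix_vector_mult_scaleR
        inner_add_left inner_add_right algebra_simps)
  then have "0 \<le> t * (a + 1 / 2 * (t * e))"
    by (simp add: algebra_simps)
  then have "0 \<le> a + 1 / 2 * (t * e)"
    using t by (simp add: zero_le_mult_iff)
  moreover have "t * (\<bar>e\<bar> + 1) \<le> - a"
    using mult_right_mono[of t "- a / (\<bar>e\<bar> + 1)" "\<bar>e\<bar> + 1"] by (simp add: t_def)
  moreover have "t * e \<le> t * \<bar>e\<bar>"
    using t by (intro mult_left_mono) auto
  ultimately show False
    using t \<open>a < 0\<close> unfolding distrib_left by linarith
qed

text \<open>The variational inequality is tested at \<open>x + axis i 1\<close> for the sign of each
  gradient entry, and at \<open>2 *\<^sub>R x\<close> and 0 for the two signs of the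
  product.\<close>

lemma quadratic_min_complementarity:
  fixes Q :: "real^'n^'n" and b :: "real^'n"
  assumes sym: "transpose Q = Q"
    and min: "is_arg_min (\<lambda>x. 1 / 2 * (x \<bullet> (Q *v x)) + x \<bullet> b) (\<lambda>x. 0 \<le> x) x"
  shows "0 \<le> Q *v x + b" "x \<bullet> (Q *v x + b) = 0"
proof -
  have conv: "convex {x::real^'n. 0 \<le> x}"
    by (auto simp: convex_def less_eq_vec_def)
  have x: "0 \<le> x"
    using min by (simp add: is_arg_min_def)
  have VI: "0 \<le> (y - x) \<bullet> (Q *v x + b)" if "0 \<le> y" for y
    using quadratic_min_variational[OF sym conv, of y b x] min that by simp
  show "0 \<le> Q *v x + b"
    unfolding less_eq_vec_def
  proof
    fix i
    have "0 \<le> x + axis i 1"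
      using x by (simp add: less_eq_vec_def axis_def)
    from VI[OF this] show "(0::real^'n) $ i \<le> (Q *v x + b) $ i"
      by (simp add: inner_axis')
  qed
  have "0 \<le> 2 *\<^sub>R x"
    using x by (simp add: less_eq_vec_def)
  from VI[OF this] VI[of 0] show "x \<bullet> (Q *v x + b) = 0"
    by (simp add: scaleR_2)
qed

section \<open>Gradients of convex functions\<close>

lemma GDERIV_unique:
  assumes "GDERIV f x :> D" "GDERIV f x :> D'"
  shows "D = D'"
proof -
  have "(\<lambda>h. h \<bullet> D) = (\<lambda>h. h \<bullet> D')"
    using assms unfolding gderiv_def by (rule has_derivative_unique)
  then show ?thesis
    by (metis vector_eq_ldot)
qed

text \<open>Restriction to the line through \<open>x\<close> and \<open>y\<close> reduces this to
  the tangent inequality in one real variable.\<close>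

lemma convex_on_above_gradient:
  assumes f: "convex_on UNIV f" and D: "GDERIV f x :> D"
  shows "f x + D \<bullet> (y - x) \<le> f y"
proof -
  define \<phi> where "\<phi> t = f (x + t *\<^sub>R (y - x))" for t :: real
  have "convex_on UNIV \<phi>"
  proof (rule convex_onI)
    fix t u v :: real
    assume t: "0 < t" "t < 1"
    have "x + ((1 - t) *\<^sub>R u + t *\<^sub>R v) *\<^sub>R (y - x)
        = (1 - t) *\<^sub>R (x + u *\<^sub>R (y - x)) + t *\<^sub>R (x + v *\<^sub>R (y - x))"
      by (simp add: algebra_simps)
    then show "\<phi> ((1 - t) *\<^sub>R u + t *\<^sub>R v) \<le> (1 - t) * \<phi> u + t * \<phi> v"
      using convex_onD[OF f, of t "x + u *\<^sub>R (y - x)" "x + v *\<^sub>R (y - x)"] t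
      by (simp add: \<phi>_def)
  qed simp
  moreover have "(\<phi> has_real_derivative D \<bullet> (y - x)) (at 0)"
  proof -
    have "((\<lambda>t. x + t *\<^sub>R (y - x)) has_derivative (\<lambda>t. t *\<^sub>R (y - x))) (at 0)"
      by (auto intro!: derivative_eq_intros)
    moreover have "(f has_derivative (\<lambda>h. h \<bullet> D)) (at (x + 0 *\<^sub>R (y - x)))"
      using D by (simp add: gderiv_def)
    ultimately have "((\<lambda>t. f (x + t *\<^sub>R (y - x))) has_derivative (\<lambda>t. (t *\<^sub>R (y - x)) \<bullet> D)) (at 0)"
      by (rule has_derivative_compose)
    then show ?thesis
      unfolding has_field_derivative_def \<phi>_def
      by (rule has_derivative_eq_rhs) (auto simp: inner_commute)
  qed
  ultimately have "\<phi> 1 - \<phi> 0 \<ge> D \<bullet> (y - x) * (1 - 0)"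
    by (intro convex_on_imp_above_tangent[where A = UNIV]) auto
  then show ?thesis by (simp add: \<phi>_def)
qed

section \<open>The Laplacian of a connected graph\<close>

lemma sum_UNIV_prod: "(\<Sum>p\<in>UNIV. f p) = (\<Sum>i\<in>UNIV. \<Sum>k\<in>UNIV. f (i, k))"
  by (simp add: sum.cartesian_product flip: UNIV_Times_UNIV)

text \<open>Paired with a consensus vector, \<open>v\<close> matters only through the sum of its
  blocks; Laplacian terms therefore drop out.\<close>

lemma inner_kron_vec_1: "v \<bullet> kron_vec 1 u = (\<Sum>k\<in>UNIV. (\<Sum>i\<in>UNIV. v $ (i, k)) * u $ k)"
proof -
  have "v \<bullet> kron_vec 1 u = (\<Sum>i\<in>UNIV. \<Sum>k\<in>UNIV. v $ (i, k) * u $ k)"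
    by (simp add: inner_vec_def kron_vec_def sum_UNIV_prod)
  also have "\<dots> = (\<Sum>k\<in>UNIV. \<Sum>i\<in>UNIV. v $ (i, k) * u $ k)"
    by (rule sum.swap)
  finally show ?thesis
    by (simp add: sum_distrib_right)
qed

lemma kron_laplacian_nth:
  "(kron (laplacian A) (mat 1) *v v) $ (i, k) = (\<Sum>j\<in>UNIV. A $ i $ j * (v $ (i, k) - v $ (j, k)))"
proof -
  have "(kron (laplacian A) (mat 1) *v v) $ (i, k)
      = (\<Sum>j\<in>UNIV. \<Sum>r\<in>UNIV. if k = r then laplacian A $ i $ j * v $ (j, r) else 0)"
    by (simp only: matrix_vector_mult_def kron_def sum_UNIV_prod mat_def vec_lambda_beta fst_conv snd_conv)
      (intro sum.cong, auto)
  also have "\<dots> = (\<Sum>j\<in>UNIV. laplacian A $ i $ j * v $ (j, k))"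
    by simp
  also have "\<dots> = (\<Sum>j\<in>UNIV. (if i = j then (\<Sum>r\<in>UNIV. A $ i $ r) * v $ (j, k) else 0)
      - A $ i $ j * v $ (j, k))"
    by (auto simp: laplacian_def diag_def matrix_vector_mult_def algebra_simps intro!: sum.cong)
  also have "\<dots> = (\<Sum>j\<in>UNIV. A $ i $ j * (v $ (i, k) - v $ (j, k)))"
    by (simp add: sum_subtractf sum_distrib_right right_diff_distrib)
  finally show ?thesis .
qed

lemma weighted_graph_swap:
  assumes "weighted_graph E A"
  shows "A $ j $ i = A $ i $ j"
proof -
  have "transpose A $ i $ j = A $ i $ j"
    using assms by (simp add: weighted_graph_def)
  then show ?thesis by (simp add: transpose_def)
qed

text \<open>By symmetry of the weights, exchanging the two players in the double sum of weighted
  differences reverses its sign.\<close>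

lemma sum_kron_laplacian:
  assumes "weighted_graph E A"
  shows "(\<Sum>i\<in>UNIV. (kron (laplacian A) (mat 1) *v v) $ (i, k)) = 0"
proof -
  let ?s = "\<Sum>i\<in>UNIV. \<Sum>j\<in>UNIV. A $ i $ j * (v $ (i, k) - v $ (j, k))"
  have "?s = (\<Sum>i\<in>UNIV. \<Sum>j\<in>UNIV. A $ j $ i * (v $ (j, k) - v $ (i, k)))"
    by (rule sum.swap)
  also have "\<dots> = (\<Sum>i\<in>UNIV. \<Sum>j\<in>UNIV. A $ i $ j * (v $ (j, k) - v $ (i, k)))"
    by (intro sum.cong refl arg_cong2[of _ _ _ _ "(*)"] weighted_graph_swap[OF assms])
  also have "\<dots> = - ?s"
    by (simp add: algebra_simps flip: sum_negf)
  finally show ?thesis by (simp add: kron_laplacian_nth)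
qed

text \<open>The Dirichlet energy of the graph, obtained by adding to the double sum its copy with
  exchanged players.\<close>

lemma inner_kron_laplacian:
  assumes "weighted_graph E A"
  shows "v \<bullet> (kron (laplacian A) (mat 1) *v v)
    = 1 / 2 * (\<Sum>k\<in>UNIV. \<Sum>i\<in>UNIV. \<Sum>j\<in>UNIV. A $ i $ j * (v $ (i, k) - v $ (j, k))\<^sup>2)"
proof -
  let ?s = "\<lambda>k. \<Sum>i\<in>UNIV. \<Sum>j\<in>UNIV. A $ i $ j * (v $ (i, k) * (v $ (i, k) - v $ (j, k)))"
  have "2 * ?s k = (\<Sum>i\<in>UNIV. \<Sum>j\<in>UNIV. A $ i $ j * (v $ (i, k) - v $ (j, k))\<^sup>2)" for k
  proof -
    have "?s k = (\<Sum>i\<in>UNIV. \<Sum>j\<in>UNIV. A $ j $ i * (v $ (j, k) * (v $ (j, k) - v $ (i, k))))"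
      by (rule sum.swap)
    also have "\<dots> = (\<Sum>i\<in>UNIV. \<Sum>j\<in>UNIV. A $ i $ j * (v $ (j, k) * (v $ (j, k) - v $ (i, k))))"
      by (intro sum.cong refl arg_cong2[of _ _ _ _ "(*)"] weighted_graph_swap[OF assms])
    finally have "2 * ?s k = ?s k + \<dots>"
      by simp
    also have "\<dots> = (\<Sum>i\<in>UNIV. \<Sum>j\<in>UNIV. A $ i $ j * (v $ (i, k) * (v $ (i, k) - v $ (j, k)))
        + A $ i $ j * (v $ (j, k) * (v $ (j, k) - v $ (i, k))))"
      by (simp only: sum.distrib)
    also have "\<dots> = (\<Sum>i\<in>UNIV. \<Sum>j\<in>UNIV. A $ i $ j * (v $ (i, k) - v $ (j, k))\<^sup>2)"
      by (intro sum.cong refl) (simp add: power2_eq_square algebra_simps)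
    finally show ?thesis .
  qed
  then have "?s k = 1 / 2 * (\<Sum>i\<in>UNIV. \<Sum>j\<in>UNIV. A $ i $ j * (v $ (i, k) - v $ (j, k))\<^sup>2)" for k
    by (simp add: field_simps)
  moreover have "v \<bullet> (kron (laplacian A) (mat 1) *v v) = (\<Sum>k\<in>UNIV. ?s k)"
    by (subst sum.swap) (simp add: inner_vec_def sum_UNIV_prod kron_laplacian_nth
        sum_distrib_left mult.left_commute)
  ultimately show ?thesis
    by (simp only: sum_distrib_left)
qed

lemma inner_kron_laplacian_nonneg:
  assumes "weighted_graph E A"
  shows "0 \<le> v \<bullet> (kron (laplacian A) (mat 1) *v v)"
  using assms unfolding inner_kron_laplacian[OF assms] weighted_graph_def
  by (simp add: sum_nonneg)

text \<open>Zero energy makes every term vanish, so values agree across edges and then along paths.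
  Assuming only that the form vanishes serves both \<open>L v = 0\<close> and the definiteness
  argument for the dual Hessian.\<close>

lemma consensus:
  assumes A: "weighted_graph E A" and E: "connected_graph E"
    and null: "v \<bullet> (kron (laplacian A) (mat 1) *v v) = 0"
  shows "\<exists>u. v = kron_vec 1 u"
proof -
  have nonneg: "0 \<le> A $ i $ j" for i j
    using A by (simp add: weighted_graph_def)
  have "(\<Sum>k\<in>UNIV. \<Sum>i\<in>UNIV. \<Sum>j\<in>UNIV. A $ i $ j * (v $ (i, k) - v $ (j, k))\<^sup>2) = 0"
    using null by (simp add: inner_kron_laplacian[OF A])
  then have zero: "A $ i $ j * (v $ (i, k) - v $ (j, k))\<^sup>2 = 0" for i j k
    by (simp add: sum_nonneg_eq_0_iff sum_nonneg nonneg)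
  have step: "v $ (i, k) = v $ (j, k)" if "(i, j) \<in> E" for i j k
  proof -
    have "0 < A $ i $ j"
      using A that by (simp add: weighted_graph_def)
    then show ?thesis using zero[of i j k] by simp
  qed
  have const: "v $ (i, k) = v $ (j, k)" for i j k
  proof -
    have "(i, j) \<in> E\<^sup>*"
      using E by (simp add: connected_graph_def)
    then show ?thesis
      by (induction rule: rtrancl_induct) (auto dest: step[where k = k])
  qed
  \<comment> \<open>All blocks coincide, so that of the arbitrary player \<open>undefined\<close>
    can serve as the common one.\<close>
  have "v $ p = kron_vec 1 (block v undefined) $ p" for p
    using const[of "fst p" "snd p" undefined] by (simp add: kron_vec_def block_def)
  then have "v = kron_vec 1 (block v undefined)"
    by (simp add: vec_eq_iff)
  then show ?thesis by blast
qed

lemma transpose_kron_laplacian: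
  assumes "weighted_graph E A"
  shows "transpose (kron (laplacian A) (mat 1)) = kron (laplacian A) (mat 1)"
  by (auto simp: vec_eq_iff transpose_def kron_def laplacian_def diag_def mat_def
      weighted_graph_swap[OF assms])

section \<open>Block matrices of the game\<close>

lemma sel_mult_nth: "(sel own *v v) $ k = v $ (own k, k)"
proof -
  have "(sel own *v v) $ k = (\<Sum>p\<in>UNIV. if p = (own k, k) then v $ p else 0)"
    by (auto simp: matrix_vector_mult_def sel_def prod_eq_iff intro!: sum.cong)
  then show ?thesis by simp
qed

lemma transpose_sel_mult_nth:
  "(transpose (sel own) *v y) $ (i, k) = (if own k = i then y $ k else 0)"
proof -
  have "(transpose (sel own) *v y) $ (i, k) = (\<Sum>r\<in>UNIV. if r = k then (if own k = i then y $ k else 0) else 0)"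
    by (simp only: matrix_vector_mult_def sel_def transpose_def vec_lambda_beta fst_conv snd_conv)
      (rule sum.cong, auto)
  then show ?thesis by simp
qed

text \<open>Coordinate \<open>k\<close> meets only the copy of \<open>u\<close> held by
  \<open>own k\<close>. This turns the stacked stationarity condition into one with a shared
  multiplier.\<close>

lemma transpose_block_diag_kron_vec:
  "transpose (block_diag own g) *v kron_vec 1 u = transpose (hcat own g) *v u"
proof -
  have "(transpose (block_diag own g) *v kron_vec 1 u) $ k = (transpose (hcat own g) *v u) $ k" for k
  proof -
    have "(transpose (block_diag own g) *v kron_vec 1 u) $ k
        = (\<Sum>i\<in>UNIV. if own k = i then (\<Sum>r\<in>UNIV. g i $ r $ k * u $ r) else 0)"
      by (simp only: matrix_vector_mult_def transpose_def block_diag_def kron_vec_def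
          sum_UNIV_prod vec_lambda_beta fst_conv snd_conv) (rule sum.cong, auto)
    then show ?thesis
      by (simp add: matrix_vector_mult_def transpose_def hcat_def)
  qed
  then show ?thesis by (simp add: vec_eq_iff)
qed

lemma sum_block_diag_mult:
  "(\<Sum>i\<in>UNIV. (block_diag own g *v x) $ (i, r)) = (hcat own g *v x) $ r"
proof -
  have "(\<Sum>i\<in>UNIV. (block_diag own g *v x) $ (i, r))
      = (\<Sum>k\<in>UNIV. \<Sum>i\<in>UNIV. if own k = i then g i $ r $ k * x $ k else 0)"
    by (subst sum.swap) (auto simp: matrix_vector_mult_def block_diag_def intro!: sum.cong)
  then show ?thesis
    by (simp add: matrix_vector_mult_def hcat_def)
qed

text \<open>Full row rank makes \<open>G\<close> onto; writing \<open>u\<close> as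
  \<open>G *v x\<close> and moving \<open>G\<close> across the inner product gives
  \<open>u \<bullet> u = 0\<close>.\<close>

lemma full_row_rank_transpose_mult_eq_0:
  fixes G :: "real^'n^'m"
  assumes "rank G = CARD('m)" "transpose G *v u = 0"
  shows "u = 0"
proof -
  obtain x where "u = G *v x"
    using assms(1) by (auto simp: full_rank_surjective surj_def)
  then have "u \<bullet> u = (transpose G *v u) \<bullet> x"
    by (simp flip: inner_matrix_vector_transpose)
  then show ?thesis by (simp add: assms(2))
qed

text \<open>Rows of \<open>G\<^sub>d\<close> may be dependent even if those of \<open>G\<close> are
  not. The Laplacian confines null vectors to consensus, where \<open>G\<^sub>d\<^sup>T\<close> acts
  as the injective \<open>G\<^sup>T\<close>.\<close>

lemma dual_hessian_pos_def:
  fixes g :: "'i::finite \<Rightarrow> real^'n::finite^'m::finite"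
  assumes "weighted_graph E A" "connected_graph E" "rank (hcat own g) = CARD('m)" "v \<noteq> 0"
  shows "0 < v \<bullet> ((block_diag own g ** transpose (block_diag own g)
      + kron (laplacian A) (mat 1)) *v v)"
proof -
  let ?w = "transpose (block_diag own g) *v v" and ?q = "v \<bullet> (kron (laplacian A) (mat 1) *v v)"
  have eq: "v \<bullet> ((block_diag own g ** transpose (block_diag own g)
      + kron (laplacian A) (mat 1)) *v v) = ?w \<bullet> ?w + ?q"
    by (simp add: matrix_vector_mult_add_rdistrib inner_add_right
        inner_matrix_vector_transpose[of v "block_diag own g"] flip: matrix_vector_mul_assoc)
  have "0 \<le> ?q"
    by (rule inner_kron_laplacian_nonneg[OF assms(1)])
  have False if "?w = 0" "?q = 0"
  proof -
    obtain u where u: "v = kron_vec 1 u"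
      using consensus[OF assms(1,2) \<open>?q = 0\<close>] by blast
    then have "u = 0"
      using \<open>?w = 0\<close> full_row_rank_transpose_mult_eq_0[OF assms(3)]
      by (simp add: transpose_block_diag_kron_vec)
    then show False
      using u \<open>v \<noteq> 0\<close> by (simp add: kron_vec_def vec_eq_iff)
  qed
  then consider "?w \<noteq> 0" | "?q \<noteq> 0"
    by blast
  then show ?thesis
  proof cases
    case 1
    then have "0 < ?w \<bullet> ?w" by simp
    then show ?thesis
      unfolding eq using \<open>0 \<le> ?q\<close> by linarith
  next
    case 2
    then show ?thesis
      unfolding eq using \<open>0 \<le> ?q\<close> inner_ge_zero[of ?w] by linarith
  qed
qed

section \<open>From KKT conditions to a variational equilibrium\<close>

lemma profile_profile [simp]: "profile own i (profile own i y x) x = profile own i y x"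
  and profile_self [simp]: "profile own i x x = x"
  by (auto simp: profile_def vec_eq_iff)

text \<open>A unilateral deviation changes only block \<open>i\<close>, where the pseudo-gradient is
  the partial gradient of \<open>J i\<close>; convexity turns the variational inequality into
  optimality.\<close>

lemma solves_VI_imp_vGNE:
  assumes C1: "\<And>i x. continuously_differentiable (\<lambda>y. J i (profile own i y x))"
    and convex: "\<And>i x. convex_on UNIV (\<lambda>y. J i (profile own i y x))"
    and VI: "solves_VI X (pseudo_grad own J) x"
  shows "is_vGNE own J X x"
proof -
  have "J i x \<le> J i (profile own i y x)" if y: "profile own i y x \<in> X" for i y
  proof -
    define y' where "y' = profile own i y x"
    obtain D where D: "GDERIV (\<lambda>y. J i (profile own i y x)) x :> D"
      using C1[of i x] by (auto simp: continuously_differentiable_def)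
    then have grad: "partial_grad own i (J i) x = D"
      unfolding partial_grad_def grad_def by (intro the_equality) (auto dest: GDERIV_unique)
    have "0 \<le> (y' - x) \<bullet> pseudo_grad own J x"
      using VI y by (simp add: solves_VI_def y'_def)
    also have "\<dots> = (y' - x) \<bullet> D"
      unfolding inner_vec_def
      by (intro sum.cong) (auto simp: y'_def profile_def pseudo_grad_def grad)
    finally show ?thesis
      using convex_on_above_gradient[OF convex D, of y'] by (simp add: y'_def inner_commute)
  qed
  moreover have "x \<in> X"
    using VI by (simp add: solves_VI_def)
  ultimately have "is_GNE own J X x"
    by (simp add: is_GNE_def is_arg_min_linorder)
  then show ?thesis
    using VI by (simp add: is_vGNE_def)
qed

text \<open>Stationarity rewrites \<open>(y - x) \<bullet> F x\<close> as the difference of the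
  multiplier's pairings with the constraint values at \<open>x\<close> and \<open>y\<close>: the
  first is zero, the second at most zero.\<close>

lemma KKT_imp_solves_VI:
  assumes stat: "F x + transpose (hcat own g) *v \<mu> = 0"
    and compl: "\<mu> \<bullet> (hcat own g *v x - (\<Sum>i\<in>UNIV. h i)) = 0"
    and feas: "hcat own g *v x - (\<Sum>i\<in>UNIV. h i) \<le> 0" and mu: "0 \<le> \<mu>"
  shows "solves_VI (feasible own g h) F x"
  unfolding solves_VI_def
proof (intro conjI ballI)
  show "x \<in> feasible own g h"
    using feas by (simp add: feasible_def)
next
  fix y
  let ?s = "\<lambda>y. hcat own g *v y - (\<Sum>i\<in>UNIV. h i)"
  assume "y \<in> feasible own g h"
  then have le: "\<mu> \<bullet> ?s y \<le> 0"
    using mu by (auto simp: feasible_def inner_vec_def less_eq_vec_def mult_nonneg_nonpos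
        intro!: sum_nonpos)
  have "F x = - (transpose (hcat own g) *v \<mu>)"
    using stat by (simp add: eq_neg_iff_add_eq_0)
  then have "(y - x) \<bullet> F x = - ((transpose (hcat own g) *v \<mu>) \<bullet> (y - x))"
    by (simp add: inner_commute)
  also have "\<dots> = - (\<mu> \<bullet> (hcat own g *v (y - x)))"
    by (simp add: inner_matrix_vector_transpose)
  also have "\<dots> = \<mu> \<bullet> ?s x - \<mu> \<bullet> ?s y"
    by (simp add: matrix_vector_mult_diff_distrib inner_diff_right)
  finally have "(y - x) \<bullet> F x = \<mu> \<bullet> ?s x - \<mu> \<bullet> ?s y" .
  then show "0 \<le> (y - x) \<bullet> F x"
    using compl le by simp
qed

section \<open>Equilibria of the dynamics\<close>

theorem lemma4p6:
  fixes own :: "'n::finite \<Rightarrow> 'i::finite"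
    and J :: "'i \<Rightarrow> real^'n \<Rightarrow> real"
    and g :: "'i \<Rightarrow> real^'n^'m::finite"
    and h :: "'i \<Rightarrow> real^'m"
    and E :: "('i \<times> 'i) set"
    and A :: "real^'i^'i"
    and c \<alpha> :: real
    and xx :: "real^('i \<times> 'n)"
    and z :: "real^('i \<times> 'm)"
  assumes C1: "\<And>i x. continuously_differentiable (\<lambda>y. J i (profile own i y x))"
    and convex: "\<And>i x. convex_on UNIV (\<lambda>y. J i (profile own i y x))"
    and slater: "slater own g h"
    and full_row_rank: "rank (hcat own g) = CARD('m)"
    and graph: "weighted_graph E A" "connected_graph E"
    and pos: "c > 0" "\<alpha> > 0"
    and equilibrium: "is_equilibrium own J g h A c \<alpha> xx z"
  defines "l \<equiv> dual_map own J g h A c \<alpha> xx z"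
    and "G \<equiv> hcat own g"
    and "H \<equiv> \<Sum>i\<in>UNIV. h i"
  shows "\<exists>xbar. xx = kron_vec 1 xbar
    \<and> pseudo_grad own J xbar + transpose (block_diag own g) *v l = 0
    \<and> l \<bullet> kron_vec 1 (G *v xbar - H) = 0
    \<and> G *v xbar - H \<le> 0
    \<and> l \<ge> 0
    \<and> (\<exists>\<mu>\<ge>0. l = kron_vec 1 \<mu>)
    \<and> xbar = sel own *v xx
    \<and> is_vGNE own J (feasible own g h) xbar"
proof -
  let ?Gd = "block_diag own g" and ?F = "ext_pseudo_grad own J xx"
  let ?Lm = "kron (laplacian A) (mat 1) :: real^('i \<times> 'm)^('i \<times> 'm)"
  let ?Ln = "kron (laplacian A) (mat 1) :: real^('i \<times> 'n)^('i \<times> 'n)"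
  \<comment> \<open>Hessian and linear coefficient of the dual objective, using that the squared
    norm of \<open>G\<^sub>d\<^sup>T v\<close> is
    \<open>v \<bullet> G\<^sub>d G\<^sub>d\<^sup>T v\<close>.\<close>
  define Q where "Q = ?Gd ** transpose ?Gd + ?Lm"
  define b where "b = ?Gd *v ?F + c *\<^sub>R (?Gd *v (sel own *v (?Ln *v xx)))
    - \<alpha> *\<^sub>R (?Gd *v (sel own *v xx) - col h) + ?Lm *v z"
  have Ql: "Q *v v = ?Gd *v (transpose ?Gd *v v) + ?Lm *v v" for v
    by (simp add: Q_def matrix_vector_mult_add_rdistrib matrix_vector_mul_assoc)
  have objective: "dual_objective own J g h A c \<alpha> xx z = (\<lambda>v. 1 / 2 * (v \<bullet> (Q *v v)) + v \<bullet> b)"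
    by (rule ext, unfold Ql dual_objective_def Let_def b_def[symmetric])
      (simp add: inner_add_right inner_matrix_vector_transpose[of _ ?Gd] power2_norm_eq_inner
        algebra_simps)
  have symQ: "transpose Q = Q"
  proof -
    have "transpose Q = transpose (?Gd ** transpose ?Gd) + transpose ?Lm"
      by (simp add: Q_def transpose_def vec_eq_iff)
    then show ?thesis
      by (simp add: Q_def matrix_transpose_mul transpose_kron_laplacian[OF graph(1)])
  qed
  have closed: "closed {v::real^('i \<times> 'm). 0 \<le> v}"
  proof -
    have "{v::real^('i \<times> 'm). 0 \<le> v} = (\<Inter>p. {v. 0 \<le> v $ p})"
      by (auto simp: less_eq_vec_def)
    then show ?thesis
      by (auto intro!: closed_INT closed_Collect_le continuous_intros)
  qed
  \<comment> \<open>\<open>dual_map\<close> is defined by choice, so its value is known to be a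
    minimizer only once one exists.\<close>
  have "\<exists>v. is_arg_min (\<lambda>v. 1 / 2 * (v \<bullet> (Q *v v)) + v \<bullet> b) (\<lambda>v. v \<in> {v. 0 \<le> v}) v"
  proof (rule quadratic_attains_min[OF _ closed])
    show "0 < v \<bullet> (Q *v v)" if "v \<noteq> 0" for v
      unfolding Q_def using dual_hessian_pos_def[OF graph full_row_rank that] .
    show "{v::real^('i \<times> 'm). 0 \<le> v} \<noteq> {}"
      by auto
  qed
  then have l_min: "is_arg_min (\<lambda>v. 1 / 2 * (v \<bullet> (Q *v v)) + v \<bullet> b) (\<lambda>v. 0 \<le> v) l"
    unfolding l_def dual_map_def objective arg_min_def by (simp add: someI_ex)
  then have l_nonneg: "0 \<le> l"
    by (simp add: is_arg_min_def)
  have Ll: "?Lm *v l = 0"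
    using equilibrium by (simp add: is_equilibrium_def z_field_def l_def)
  then obtain \<mu> where \<mu>: "l = kron_vec 1 \<mu>"
    using consensus[OF graph, of l] by auto
  have \<mu>_nonneg: "0 \<le> \<mu>"
    using l_nonneg by (simp add: \<mu> less_eq_vec_def kron_vec_def)
  \<comment> \<open>The residual of KKT stationarity, through which both \<open>?F\<close> and the
    multiplier enter \<open>x_field\<close>.\<close>
  define y where "y = ?F + transpose ?Gd *v l"
  have "transpose (sel own) *v y + c *\<^sub>R (?Ln *v xx) = - x_field own J g h A c \<alpha> xx z"
    by (simp add: x_field_def l_def y_def matrix_vector_right_distrib)
  then have eq: "transpose (sel own) *v y + c *\<^sub>R (?Ln *v xx) = 0"
    using equilibrium by (simp add: is_equilibrium_def)
  have stat: "y = 0"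
  proof -
    have "y $ k = 0" for k
    proof -
      \<comment> \<open>Summed over players, the Laplacian term cancels, while
        \<open>transpose (sel own)\<close> puts \<open>y $ k\<close> into the block of
        \<open>own k\<close> alone.\<close>
      have "0 = (\<Sum>i\<in>UNIV. (transpose (sel own) *v y + c *\<^sub>R (?Ln *v xx)) $ (i, k))"
        by (simp add: eq)
      also have "\<dots> = y $ k"
        by (simp add: sum.distrib transpose_sel_mult_nth sum_kron_laplacian[OF graph(1)]
            flip: sum_distrib_left)
      finally show ?thesis by simp
    qed
    then show ?thesis by (simp add: vec_eq_iff)
  qed
  then have Lx: "?Ln *v xx = 0"
    using eq pos by simp
  then obtain x where x: "xx = kron_vec 1 x"
    using consensus[OF graph, of xx] by auto
  have "block xx i = x" for i
    by (simp add: x block_def kron_vec_def vec_eq_iff)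
  then have F: "?F = pseudo_grad own J x"
    by (simp add: ext_pseudo_grad_def pseudo_grad_def)
  have sel: "sel own *v xx = x"
    by (simp add: vec_eq_iff sel_mult_nth x kron_vec_def)

  \<comment> \<open>The gradient of the dual objective at \<open>l\<close>. Stationarity removes
    \<open>?Gd *v y\<close>, and consensus removes the Laplacians of \<open>l\<close> and
    \<open>xx\<close>.\<close>
  define w where "w = Q *v l + b"
  have "w = ?Gd *v y - \<alpha> *\<^sub>R (?Gd *v x - col h) + ?Lm *v z"
    by (simp add: w_def Ql b_def y_def Ll Lx sel matrix_vector_right_distrib)
  then have w: "w = ?Lm *v z - \<alpha> *\<^sub>R (?Gd *v x - col h)"
    by (simp add: stat)
  \<comment> \<open>Summation eliminates \<open>?Lm *v z\<close>, about which the equilibrium gives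
    no direct information, and assembles the global constraint.\<close>
  have w_sum: "(\<Sum>i\<in>UNIV. w $ (i, r)) = - \<alpha> * (G *v x - H) $ r" for r
    by (simp add: w sum_subtractf sum_kron_laplacian[OF graph(1)] sum_block_diag_mult G_def H_def
        col_def flip: sum_distrib_left)
  have w_nonneg: "0 \<le> w" and "l \<bullet> w = 0"
    using quadratic_min_complementarity[OF symQ l_min] by (simp_all add: w_def)
  have feas: "G *v x - H \<le> 0"
    unfolding less_eq_vec_def
  proof
    fix r
    have "0 \<le> - \<alpha> * (G *v x - H) $ r"
      unfolding w_sum[symmetric] using w_nonneg by (intro sum_nonneg) (simp add: less_eq_vec_def)
    then show "(G *v x - H) $ r \<le> 0 $ r"
      using pos by (simp add: mult_le_0_iff)
  qed
  \<comment> \<open>Because \<open>l\<close> is in consensus, complementarity with \<open>w\<close>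
    involves only its block sums; the positive factor \<alpha> then divides out.\<close>
  have "l \<bullet> w = (\<Sum>r\<in>UNIV. - \<alpha> * (G *v x - H) $ r * \<mu> $ r)"
    by (simp only: \<mu> inner_commute[of _ w] inner_kron_vec_1 w_sum)
  also have "\<dots> = - \<alpha> * (\<mu> \<bullet> (G *v x - H))"
    by (simp add: inner_vec_def sum_distrib_left mult_ac flip: sum_negf)
  finally have compl: "\<mu> \<bullet> (G *v x - H) = 0"
    using \<open>l \<bullet> w = 0\<close> pos by simp
  \<comment> \<open>Both vectors repeat one block per player, hence the number of players as a
    factor.\<close>
  have "l \<bullet> kron_vec 1 (G *v x - H) = real CARD('i) * (\<mu> \<bullet> (G *v x - H))"
    by (simp add: inner_kron_vec_1 \<mu>, simp add: kron_vec_def inner_vec_def sum_distrib_left mult_ac)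
  then have compl': "l \<bullet> kron_vec 1 (G *v x - H) = 0"
    by (simp add: compl)
  have "pseudo_grad own J x + transpose (hcat own g) *v \<mu> = 0"
    using stat by (simp add: y_def F \<mu> transpose_block_diag_kron_vec)
  then have "solves_VI (feasible own g h) (pseudo_grad own J) x"
    using compl feas \<mu>_nonneg by (intro KKT_imp_solves_VI) (simp_all add: G_def H_def)
  then have "is_vGNE own J (feasible own g h) x"
    by (rule solves_VI_imp_vGNE[OF C1 convex])
  moreover have "pseudo_grad own J x + transpose ?Gd *v l = 0"
    using stat by (simp add: y_def F)
  ultimately show ?thesis
    using x compl' feas l_nonneg \<mu> \<mu>_nonneg sel by (intro exI[of _ x] conjI exI[of _ \<mu>]) auto
qed

end
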